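(* Let $k$ be a positive real number. The generating function $r_k(x)=\sum_{i=0}^{\infty} r_{k,i}x^{i}$ of the rising $k$-binomial transform $(r_{k,n})_{n\ge 0}$ of the modified $k$-Fibonacci-like sequence is, as a formal power series in $x$, $$r_{k}(x) = \frac{2-(2k^{2}-2k+2)x}{1-(k^{2}+2)x+x^{2}}.$$
   Context: For a positive real number $k$, the modified $k$-Fibonacci-like sequence $(M_{k,n})_{n\ge 0}$ is defined by $M_{k,0}=M_{k,1}=2$ and $M_{k,n+1}=kM_{k,n}+M_{k,n-1}$ for $n\ge 1$. Its rising $k$-binomial transform $(r_{k,n})_{n\ge 0}$ is defined by $r_{k,n}=\sum_{i=0}^{n}\binom{n}{i}k^{i}M_{k,i}$. *)

theory Defs
  imports Complex_Main "HOL-Computational_Algebra.Formal_Power_Series"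
begin

fun mod_fib_like :: "real \<Rightarrow> nat \<Rightarrow> real" where
  "mod_fib_like k 0 = 2"
| "mod_fib_like k (Suc 0) = 2"
| "mod_fib_like k (Suc (Suc n)) = k * mod_fib_like k (Suc n) + mod_fib_like k n"

definition rising_binomial_transform :: "real \<Rightarrow> (nat \<Rightarrow> real) \<Rightarrow> nat \<Rightarrow> real" where
  "rising_binomial_transform k a n = (\<Sum>i = 0..n. real (n choose i) * k ^ i * a i)"

end

theory Submission
  imports Defs
begin

text \<open>
  Write \<open>B\<close> for the rising binomial transform and \<open>S\<close> for the shift of sequences. Pascal's rule
  says that shifting the transformed sequence amounts to applying \<open>1 + k S\<close> before transforming:
  \<open>S B = B (1 + k S)\<close>. A sequence with \<open>S\<^sup>2 = k S + 1\<close>, such as the modified Fibonacci-like one,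
  is thus carried to one on which \<open>S\<close> acts as \<open>1 + k S\<close> acts on the original, and
  \<open>(1 + k S)\<^sup>2 = 1 + 2 k S + k\<^sup>2 (k S + 1) = (k\<^sup>2 + 2) (1 + k S) - 1\<close>.
  This is the recurrence with characteristic polynomial \<open>t\<^sup>2 - (k\<^sup>2 + 2) t + 1\<close>, whose reversal is
  the denominator of the generating function; the numerator records the two initial values
  \<open>2\<close> and \<open>2 + 2 k\<close>.
\<close>

text \<open>The intertwining relation \<open>S B = B (1 + k S)\<close>, which is Pascal's rule summed.\<close>

lemma rising_binomial_transform_Suc:
  "rising_binomial_transform k a (Suc n) =
     rising_binomial_transform k a n + k * rising_binomial_transform k (\<lambda>i. a (Suc i)) n"
proof -
  have "rising_binomial_transform k a (Suc n) =
      a 0 + (\<Sum>i=0..n. real (Suc n choose Suc i) * k ^ Suc i * a (Suc i))"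
    unfolding rising_binomial_transform_def by (subst sum.atLeast0_atMost_Suc_shift) simp
  also have "\<dots> = (a 0 + (\<Sum>i=0..n. real (n choose Suc i) * k ^ Suc i * a (Suc i)))
      + (\<Sum>i=0..n. real (n choose i) * k ^ Suc i * a (Suc i))"
    by (simp add: distrib_right sum.distrib)
  also have "a 0 + (\<Sum>i=0..n. real (n choose Suc i) * k ^ Suc i * a (Suc i)) =
      (\<Sum>i=0..Suc n. real (n choose i) * k ^ i * a i)"
    by (subst sum.atLeast0_atMost_Suc_shift) simp
  also have "\<dots> = rising_binomial_transform k a n"
    by (simp add: rising_binomial_transform_def)
  also have "(\<Sum>i=0..n. real (n choose i) * k ^ Suc i * a (Suc i)) =
      k * rising_binomial_transform k (\<lambda>i. a (Suc i)) n"
    by (simp add: rising_binomial_transform_def sum_distrib_left mult_ac)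
  finally show ?thesis .
qed

lemma rising_binomial_transform_linear:
  "rising_binomial_transform k (\<lambda>i. c * a i + b i) n =
     c * rising_binomial_transform k a n + rising_binomial_transform k b n"
  by (simp add: rising_binomial_transform_def sum_distrib_left sum.distrib distrib_left mult_ac)

lemma rising_binomial_transform_recurrence:
  assumes "\<And>i. a (Suc (Suc i)) = k * a (Suc i) + a i"
  shows "rising_binomial_transform k a (Suc (Suc n)) =
    (k ^ 2 + 2) * rising_binomial_transform k a (Suc n) - rising_binomial_transform k a n"
proof -
  have "rising_binomial_transform k (\<lambda>i. a (Suc (Suc i))) n =
      k * rising_binomial_transform k (\<lambda>i. a (Suc i)) n + rising_binomial_transform k a n"
    by (simp only: assms rising_binomial_transform_linear)
  then show ?thesis
    by (simp add: rising_binomial_transform_Suc power2_eq_square) (simp add: algebra_simps)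
qed

lemma Abs_fps_linear_recurrence:
  fixes r :: "nat \<Rightarrow> 'a::field"
  assumes "\<And>n. r (Suc (Suc n)) = p * r (Suc n) - r n"
  shows "Abs_fps r =
    (fps_const (r 0) - fps_const (p * r 0 - r 1) * fps_X) / (1 - fps_const p * fps_X + fps_X ^ 2)"
    (is "_ = ?N / ?D")
proof -
  have "Abs_fps r * ?D = ?N"
  proof (rule fps_ext)
    fix n
    have expand: "Abs_fps r * ?D =
        Abs_fps r - fps_const p * (fps_X * Abs_fps r) + fps_X * (fps_X * Abs_fps r)"
      by (simp add: algebra_simps power2_eq_square)
    consider "n = 0" | "n = 1" | m where "n = Suc (Suc m)"
      by (metis One_nat_def not0_implies_Suc)
    then show "fps_nth (Abs_fps r * ?D) n = fps_nth ?N n"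
      unfolding expand by cases (simp_all add: assms)
  qed
  moreover have "fps_nth ?D 0 \<noteq> 0"
    by simp
  then have "?D \<noteq> 0"
    by (metis fps_zero_nth)
  ultimately show ?thesis
    by (metis nonzero_mult_div_cancel_right)
qed

theorem mainTheorem9:
  fixes k :: real
  assumes "k > 0"
  shows "Abs_fps (rising_binomial_transform k (mod_fib_like k)) =
    (fps_const 2 - fps_const (2 * k ^ 2 - 2 * k + 2) * fps_X) /
    (1 - fps_const (k ^ 2 + 2) * fps_X + fps_X ^ 2)"
proof -
  let ?r = "rising_binomial_transform k (mod_fib_like k)"
  have init: "?r 0 = 2" "?r 1 = 2 + 2 * k"
    by (simp_all add: rising_binomial_transform_def)
  have numerator: "(k ^ 2 + 2) * ?r 0 - ?r 1 = 2 * k ^ 2 - 2 * k + 2"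
    unfolding init by (simp add: algebra_simps)
  have "?r (Suc (Suc n)) = (k ^ 2 + 2) * ?r (Suc n) - ?r n" for n
    by (rule rising_binomial_transform_recurrence) simp
  from Abs_fps_linear_recurrence[of ?r, OF this] show ?thesis
    by (simp only: numerator) (simp only: init)
qed

end
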